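(* Let $F$ be a field, let $D$ be a division algebra with center $F$ and degree $d>2$, let $K|F$ be any splitting field of $D$, and regard $D$ as an $F$-subalgebra of $M_d(K)$ via a splitting representation, so that $D^\times\le\mathrm{GL}_d(K)$. Let $\Delta$ be the spherical building associated to $\mathrm{GL}_d(K)$. Then $D^\times$ does not act weakly transitively on $\Delta$.
   Context: A division algebra $D$ with center $F$ has degree $d$ if $\dim_F(D)=d^2$. A splitting field of $D$ is a field extension $K|F$ with $D\otimes_F K\cong M_d(K)$; a splitting representation is the resulting injective $F$-algebra homomorphism $D\hookrightarrow D\otimes_F K\cong M_d(K)$. The spherical building $\Delta$ associated to $\mathrm{GL}_d(K)$ is the flag complex of proper nonzero subspaces of $K^d$; its chambers are the maximal flags, and its apartments correspond to unordered decompositions of $K^d$ into $d$ lines (frames): the apartment of a frame $\{L_1,\dots,L_d\}$ consists of the flags of subspaces spanned by subsets of the frame. A type-preserving action of a group $H$ on a building $\Delta$ is weakly transitive if there exists an apartment $\Sigma$ in the complete apartment system of $\Delta$ such that $\mathrm{Stab}_H(\Sigma)$ acts transitively on the set of chambers of $\Sigma$. *)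

theory Defs
  imports "HOL-Analysis.Analysis" "HOL-Library.Poly_Mapping" "HOL-Algebra.QuotRing"
    "HOL-Algebra.Generated_Groups"
begin

section \<open>Central division algebras and field extensions\<close>

definition unital_ring_hom :: "('a::ring_1 \<Rightarrow> 'b::ring_1) \<Rightarrow> bool" where
  "unital_ring_hom h \<longleftrightarrow>
     h 1 = 1 \<and> (\<forall>x y. h (x + y) = h x + h y) \<and> (\<forall>x y. h (x * y) = h x * h y)"

text \<open>Structure maps of algebras are explicit. A unital homomorphism from a field to a nonzero
  ring is injective, so a field extension \<open>K|F\<close> is just a unital homomorphism \<open>j\<close> from \<open>F\<close> to \<open>K\<close>,
  and a division algebra with center \<open>F\<close> is a division ring with a unital homomorphism \<open>\<iota>\<close> from \<open>F\<close>
  onto its center.\<close>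

definition ring_center :: "'a::ring_1 set" where
  "ring_center = {z. \<forall>x. z * x = x * z}"

definition central_division_algebra :: "('f::field \<Rightarrow> 'd::division_ring) \<Rightarrow> bool" where
  "central_division_algebra \<iota> \<longleftrightarrow> unital_ring_hom \<iota> \<and> range \<iota> = ring_center"

text \<open>For \<open>d > 0\<close> this includes finite-dimensionality, since \<^const>\<open>vector_space.dim\<close> is \<open>0\<close> on
  infinite-dimensional spaces.\<close>

definition has_algebra_degree :: "('f::field \<Rightarrow> 'd::division_ring) \<Rightarrow> nat \<Rightarrow> bool" where
  "has_algebra_degree \<iota> d \<longleftrightarrow> vector_space.dim (\<lambda>f x. \<iota> f * x) (UNIV :: 'd set) = d\<^sup>2"

definition field_extension :: "('f::field \<Rightarrow> 'k::field) \<Rightarrow> bool" where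
  "field_extension j \<longleftrightarrow> unital_ring_hom j"

section \<open>The tensor product \<open>D \<otimes>\<^sub>F K\<close>\<close>

text \<open>The ring of formal integer combinations of pairs \<open>(a, k)\<close>, with \<open>(a, k) (b, l) = (a b, k l)\<close>.
  Its quotient by the additive subgroup generated by the bilinearity relations is \<open>D \<otimes>\<^sub>F K\<close>.\<close>

definition formal_mult ::
    "('d::ring_1 \<times> 'k::ring_1 \<Rightarrow>\<^sub>0 int) \<Rightarrow> ('d \<times> 'k \<Rightarrow>\<^sub>0 int) \<Rightarrow> ('d \<times> 'k \<Rightarrow>\<^sub>0 int)" where
  "formal_mult s t = frag_extend (\<lambda>(a, k). frag_extend (\<lambda>(b, l). frag_of (a * b, k * l)) t) s"

definition formal_ring :: "('d::ring_1 \<times> 'k::ring_1 \<Rightarrow>\<^sub>0 int) ring" where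
  "formal_ring =
     \<lparr>carrier = UNIV, mult = formal_mult, one = frag_of (1, 1), zero = 0, add = (+)\<rparr>"

definition bilinearity_relations ::
    "('f::field \<Rightarrow> 'd::division_ring) \<Rightarrow> ('f \<Rightarrow> 'k::field) \<Rightarrow> ('d \<times> 'k \<Rightarrow>\<^sub>0 int) set" where
  "bilinearity_relations \<iota> j =
     {frag_of (a + b, k) - frag_of (a, k) - frag_of (b, k) | a b k. True} \<union>
     {frag_of (a, k + l) - frag_of (a, k) - frag_of (a, l) | a k l. True} \<union>
     {frag_of (\<iota> f * a, k) - frag_of (a, j f * k) | f a k. True}"

definition tensor_null ::
    "('f::field \<Rightarrow> 'd::division_ring) \<Rightarrow> ('f \<Rightarrow> 'k::field) \<Rightarrow> ('d \<times> 'k \<Rightarrow>\<^sub>0 int) set" where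
  "tensor_null \<iota> j = generate (add_monoid formal_ring) (bilinearity_relations \<iota> j)"

definition tensor_algebra ::
    "('f::field \<Rightarrow> 'd::division_ring) \<Rightarrow> ('f \<Rightarrow> 'k::field) \<Rightarrow> ('d \<times> 'k \<Rightarrow>\<^sub>0 int) set ring" where
  "tensor_algebra \<iota> j = formal_ring Quot tensor_null \<iota> j"

definition pure_tensor ::
    "('f::field \<Rightarrow> 'd::division_ring) \<Rightarrow> ('f \<Rightarrow> 'k::field) \<Rightarrow> 'd \<Rightarrow> 'k \<Rightarrow> ('d \<times> 'k \<Rightarrow>\<^sub>0 int) set" where
  "pure_tensor \<iota> j a k = tensor_null \<iota> j +>\<^bsub>formal_ring\<^esub> frag_of (a, k)"

lemma formal_mult_add_left: "formal_mult (s + s') t = formal_mult s t + formal_mult s' t"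
  by (simp add: formal_mult_def frag_extend_add)

lemma formal_mult_diff_left: "formal_mult (s - s') t = formal_mult s t - formal_mult s' t"
  by (simp add: formal_mult_def frag_extend_diff)

lemma formal_mult_of: "formal_mult (frag_of (a, k)) (frag_of (b, l)) = frag_of (a * b, k * l)"
  by (simp add: formal_mult_def)

lemma formal_mult_zero [simp]: "formal_mult 0 t = 0" "formal_mult s 0 = 0"
  by (auto simp: formal_mult_def intro!: frag_extend_eq_0)

lemma formal_mult_add_right: "formal_mult s (t + t') = formal_mult s t + formal_mult s t'"
proof -
  have "(\<lambda>(a, k). frag_extend (\<lambda>(b, l). frag_of (a * b, k * l)) (t + t')) =
      (\<lambda>x. (\<lambda>(a, k). frag_extend (\<lambda>(b, l). frag_of (a * b, k * l)) t) x +
           (\<lambda>(a, k). frag_extend (\<lambda>(b, l). frag_of (a * b, k * l)) t') x)"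
    by (auto simp: frag_extend_add fun_eq_iff)
  then show ?thesis
    unfolding formal_mult_def
    by (simp only: frag_extend_def[of _ s] frag_cmul_distrib2 sum.distrib)
qed

lemma formal_mult_diff_right: "formal_mult s (t - t') = formal_mult s t - formal_mult s t'"
  using formal_mult_add_right[of s "t - t'" t'] by simp

lemma frag_generated_induct [case_names zero of diff]:
  assumes "P 0" "\<And>x. P (frag_of x)" "\<And>a b. P a \<Longrightarrow> P b \<Longrightarrow> P (a - b)"
  shows "P (c :: 'a \<Rightarrow>\<^sub>0 int)"
  by (rule frag_induction[of c UNIV P]) (use assms in auto)

lemma formal_mult_assoc: "formal_mult (formal_mult s t) u = formal_mult s (formal_mult t u)"
proof (induction s rule: frag_generated_induct)
  case (of x)
  obtain a k where x: "x = (a, k)" by (cases x)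
  show ?case
  proof (induction t rule: frag_generated_induct)
    case (of y)
    obtain b l where y: "y = (b, l)" by (cases y)
    show ?case
    proof (induction u rule: frag_generated_induct)
      case (of z)
      obtain c m where z: "z = (c, m)" by (cases z)
      show ?case by (simp add: x y z formal_mult_of mult.assoc)
    qed (simp_all add: formal_mult_diff_right)
  qed (simp_all add: formal_mult_diff_right formal_mult_diff_left)
qed (simp_all add: formal_mult_diff_left)

lemma formal_mult_one:
  "formal_mult (frag_of (1, 1)) s = s" "formal_mult s (frag_of (1, 1)) = s"
proof -
  show "formal_mult (frag_of (1, 1)) s = s"
    by (induction s rule: frag_generated_induct) (auto simp: formal_mult_diff_right formal_mult_of)
  show "formal_mult s (frag_of (1, 1)) = s"
    by (induction s rule: frag_generated_induct) (auto simp: formal_mult_diff_left formal_mult_of)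
qed

lemma ring_formal_ring: "ring (formal_ring :: ('d::ring_1 \<times> 'k::ring_1 \<Rightarrow>\<^sub>0 int) ring)"
proof (rule ringI)
  show "abelian_group (formal_ring :: ('d \<times> 'k \<Rightarrow>\<^sub>0 int) ring)"
    by (rule abelian_groupI)
      (auto simp: formal_ring_def add.assoc add.commute intro: exI[of _ "- _"] left_minus)
  show "Group.monoid (formal_ring :: ('d \<times> 'k \<Rightarrow>\<^sub>0 int) ring)"
    by (rule Group.monoidI) (auto simp: formal_ring_def formal_mult_assoc formal_mult_one)
qed (auto simp: formal_ring_def formal_mult_add_left formal_mult_add_right)

lemma a_inv_formal_ring: "inv\<^bsub>add_monoid formal_ring\<^esub> (x :: 'd::ring_1 \<times> 'k::ring_1 \<Rightarrow>\<^sub>0 int) = - x"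
proof -
  interpret ring "formal_ring :: ('d \<times> 'k \<Rightarrow>\<^sub>0 int) ring" by (rule ring_formal_ring)
  have "\<ominus>\<^bsub>formal_ring\<^esub> x = - x"
    by (rule minus_equality) (auto simp: formal_ring_def)
  then show ?thesis by (simp add: a_inv_def)
qed

text \<open>The subgroup of relations is automatically a two-sided ideal, so the multiplication
  \<open>(a \<otimes> k) (b \<otimes> l) = a b \<otimes> k l\<close> of the quotient is well defined.\<close>

lemma tensor_null_ideal:
  fixes \<iota> :: "'f::field \<Rightarrow> 'd::division_ring" and j :: "'f \<Rightarrow> 'k::field"
  assumes "central_division_algebra \<iota>"
  shows "ideal (tensor_null \<iota> j) formal_ring"
proof -
  interpret R: ring "formal_ring :: ('d \<times> 'k \<Rightarrow>\<^sub>0 int) ring" by (rule ring_formal_ring)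
  let ?I = "tensor_null \<iota> j"
  have zero: "0 \<in> ?I"
    using generate.one[of "add_monoid (formal_ring :: ('d \<times> 'k \<Rightarrow>\<^sub>0 int) ring)"]
    by (simp add: tensor_null_def formal_ring_def)
  have incl: "x \<in> ?I" if "x \<in> bilinearity_relations \<iota> j" for x
    using that by (simp add: tensor_null_def generate.incl)
  have add: "x + y \<in> ?I" if "x \<in> ?I" "y \<in> ?I" for x y
    using generate.eng[of x "add_monoid formal_ring" "bilinearity_relations \<iota> j" y] that
    by (simp add: tensor_null_def formal_ring_def)
  have sub: "subgroup ?I (add_monoid formal_ring)"
    unfolding tensor_null_def by (rule R.add.generate_is_subgroup) (simp add: formal_ring_def)
  have neg: "- x \<in> ?I" if "x \<in> ?I" for x
    using subgroup.m_inv_closed[OF sub that] by (simp only: a_inv_formal_ring)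
  have diff: "x - y \<in> ?I" if "x \<in> ?I" "y \<in> ?I" for x y
    using add[OF that(1) neg[OF that(2)]] by simp
  have central: "\<iota> f * x = x * \<iota> f" for f x
    using assms by (auto simp: central_division_algebra_def ring_center_def)
  have gens: "formal_mult x r \<in> ?I \<and> formal_mult r x \<in> ?I"
    if x: "x \<in> bilinearity_relations \<iota> j" for x r
  proof (induction r rule: frag_generated_induct)
    case (of y)
    obtain b l where y: "y = (b, l)" by (cases y)
    from x consider
        (left) a a' k where "x = frag_of (a + a', k) - frag_of (a, k) - frag_of (a', k)"
      | (right) a k k' where "x = frag_of (a, k + k') - frag_of (a, k) - frag_of (a, k')"
      | (scalar) f a k where "x = frag_of (\<iota> f * a, k) - frag_of (a, j f * k)"
      by (auto simp: bilinearity_relations_def)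
    then have "formal_mult x (frag_of y) \<in> bilinearity_relations \<iota> j \<and>
               formal_mult (frag_of y) x \<in> bilinearity_relations \<iota> j"
    proof cases
      case left
      have "formal_mult x (frag_of y) =
          frag_of (a * b + a' * b, k * l) - frag_of (a * b, k * l) - frag_of (a' * b, k * l)"
        by (simp add: left y formal_mult_diff_left formal_mult_of distrib_right)
      moreover have "formal_mult (frag_of y) x =
          frag_of (b * a + b * a', l * k) - frag_of (b * a, l * k) - frag_of (b * a', l * k)"
        by (simp add: left y formal_mult_diff_right formal_mult_of distrib_left)
      ultimately show ?thesis
        unfolding bilinearity_relations_def by blast
    next
      case right
      have "formal_mult x (frag_of y) =
          frag_of (a * b, k * l + k' * l) - frag_of (a * b, k * l) - frag_of (a * b, k' * l)"
        by (simp add: right y formal_mult_diff_left formal_mult_of distrib_right)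
      moreover have "formal_mult (frag_of y) x =
          frag_of (b * a, l * k + l * k') - frag_of (b * a, l * k) - frag_of (b * a, l * k')"
        by (simp add: right y formal_mult_diff_right formal_mult_of distrib_left)
      ultimately show ?thesis
        unfolding bilinearity_relations_def by blast
    next
      case scalar
      have "formal_mult x (frag_of y) = frag_of (\<iota> f * (a * b), k * l) - frag_of (a * b, j f * (k * l))"
        by (simp add: scalar y formal_mult_diff_left formal_mult_of mult.assoc)
      moreover have "b * (\<iota> f * a) = \<iota> f * (b * a)"
        by (metis central mult.assoc)
      then have "formal_mult (frag_of y) x = frag_of (\<iota> f * (b * a), l * k) - frag_of (b * a, j f * (l * k))"
        by (simp add: scalar y formal_mult_diff_right formal_mult_of mult.left_commute)
      ultimately show ?thesis
        unfolding bilinearity_relations_def by blast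
    qed
    then show ?case using incl by blast
  qed (auto simp: zero diff formal_mult_diff_left formal_mult_diff_right)
  have mult: "formal_mult x r \<in> ?I \<and> formal_mult r x \<in> ?I" if "x \<in> ?I" for x r
    using that unfolding tensor_null_def
  proof (induction x rule: generate.induct)
    case one
    then show ?case using zero by (simp add: formal_ring_def tensor_null_def)
  next
    case (incl h)
    then show ?case using gens by (simp add: tensor_null_def)
  next
    case (inv h)
    have "formal_mult (- h) r = - formal_mult h r" "formal_mult r (- h) = - formal_mult r h"
      using formal_mult_diff_left[of 0 h r] formal_mult_diff_right[of r 0 h] by simp_all
    then show ?case using gens[OF inv, of r] neg by (simp only: a_inv_formal_ring tensor_null_def simp_thms)
  next
    case (eng h1 h2)
    then show ?case using add
      by (simp add: formal_ring_def tensor_null_def formal_mult_add_left formal_mult_add_right)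
  qed
  show ?thesis
    by (rule idealI[OF ring_formal_ring sub]) (use mult in \<open>auto simp: formal_ring_def\<close>)
qed

section \<open>Splitting fields and splitting representations\<close>

definition matrix_ring :: "('k::field ^ 'n ^ 'n) ring" where
  "matrix_ring = \<lparr>carrier = UNIV, mult = (**), one = mat 1, zero = 0, add = (+)\<rparr>"

text \<open>An isomorphism \<open>D \<otimes>\<^sub>F K \<cong> M\<^sub>d(K)\<close> of \<open>K\<close>-algebras; \<open>\<^const>\<open>mat\<close> k\<close> is the scalar matrix
  \<open>k I\<close>. The field \<open>K\<close> is a splitting field iff such an isomorphism exists.\<close>

definition splitting_isomorphism ::
    "('f::field \<Rightarrow> 'd::division_ring) \<Rightarrow> ('f \<Rightarrow> 'k::field) \<Rightarrow>
     (('d \<times> 'k \<Rightarrow>\<^sub>0 int) set \<Rightarrow> 'k ^ 'n ^ 'n) \<Rightarrow> bool" where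
  "splitting_isomorphism \<iota> j \<psi> \<longleftrightarrow>
     \<psi> \<in> ring_iso (tensor_algebra \<iota> j) matrix_ring \<and> (\<forall>k. \<psi> (pure_tensor \<iota> j 1 k) = mat k)"

definition splitting_representation ::
    "('f::field \<Rightarrow> 'd::division_ring) \<Rightarrow> ('f \<Rightarrow> 'k::field) \<Rightarrow> ('d \<Rightarrow> 'k ^ 'n ^ 'n) \<Rightarrow> bool" where
  "splitting_representation \<iota> j \<phi> \<longleftrightarrow>
     (\<exists>\<psi>. splitting_isomorphism \<iota> j \<psi> \<and> (\<forall>a. \<phi> a = \<psi> (pure_tensor \<iota> j a 1)))"

section \<open>The spherical building of \<open>GL\<^sub>d(K)\<close>\<close>

definition building :: "('k::field ^ 'n) set set set" where
  "building = {\<sigma>. (\<forall>U\<in>\<sigma>. vec.subspace U \<and> U \<noteq> {0} \<and> U \<noteq> UNIV) \<and> chain\<^sub>\<subseteq> \<sigma>}"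

text \<open>A frame: \<open>d\<close> lines such that every vector is uniquely a sum of one vector from each line.\<close>

definition frame :: "('k::field ^ 'n) set set \<Rightarrow> bool" where
  "frame \<L> \<longleftrightarrow> card \<L> = CARD('n) \<and> (\<forall>L\<in>\<L>. vec.subspace L \<and> vec.dim L = 1) \<and>
     (\<forall>v. \<exists>!c. c \<in> (\<Pi>\<^sub>E L\<in>\<L>. L) \<and> v = (\<Sum>L\<in>\<L>. c L))"

definition frame_apartment :: "('k::field ^ 'n) set set \<Rightarrow> ('k ^ 'n) set set set" where
  "frame_apartment \<L> = {\<sigma>\<in>building. \<forall>U\<in>\<sigma>. \<exists>S\<subseteq>\<L>. U = vec.span (\<Union>S)}"

definition apartments :: "('k::field ^ 'n) set set set set" where
  "apartments = {frame_apartment \<L> | \<L>. frame \<L>}"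

section \<open>Weak transitivity\<close>

text \<open>Simplicial complexes are sets of simplices, and simplices are sets of vertices. The map
  \<open>act\<close> gives the action on vertices. Linear automorphisms preserve dimension, so
  the action on the building is type-preserving.\<close>

definition chambers :: "'v set set \<Rightarrow> 'v set set" where
  "chambers \<Sigma> = {C\<in>\<Sigma>. \<forall>\<sigma>\<in>\<Sigma>. C \<subseteq> \<sigma> \<longrightarrow> \<sigma> = C}"

definition complex_stabilizer :: "'g set \<Rightarrow> ('g \<Rightarrow> 'v \<Rightarrow> 'v) \<Rightarrow> 'v set set \<Rightarrow> 'g set" where
  "complex_stabilizer H act \<Sigma> = {h\<in>H. (\<lambda>\<sigma>. act h ` \<sigma>) ` \<Sigma> = \<Sigma>}"

definition weakly_transitive :: "'g set \<Rightarrow> ('g \<Rightarrow> 'v \<Rightarrow> 'v) \<Rightarrow> 'v set set set \<Rightarrow> bool" where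
  "weakly_transitive H act \<A> \<longleftrightarrow>
     (\<exists>\<Sigma>\<in>\<A>. \<forall>C\<in>chambers \<Sigma>. \<forall>C'\<in>chambers \<Sigma>. \<exists>h\<in>complex_stabilizer H act \<Sigma>. act h ` C = C')"

definition linear_action :: "('g \<Rightarrow> 'k::field ^ 'n ^ 'n) \<Rightarrow> 'g \<Rightarrow> ('k ^ 'n) set \<Rightarrow> ('k ^ 'n) set" where
  "linear_action \<phi> g U = (*v) (\<phi> g) ` U"

end

theory Submission
  imports Defs
begin

text \<open>The idea is that a division ring \<open>D\<close> of matrices is too rigid to permute a frame freely: an
  element is determined by its value on a single nonzero vector, because the difference of two
  elements is zero or invertible (\<open>matrix_representation_eqI\<close>).

  In the apartment of a frame the chambers are the flags obtained by adding the lines one at a time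
  in some order. Weak transitivity therefore provides, for every permutation of the lines, a nonzero
  element of \<open>D\<close> that realizes it (\<open>list_flag_is_chamber\<close>, \<open>stabilizer_maps_lines_in_order\<close>). Only
  the transpositions are used below.

  Let \<open>t \<in> D\<close> preserve every line, and let \<open>n \<in> D\<close> swap the lines \<open>A\<close> and \<open>B\<close>. As there are at least
  three lines, \<open>t\<close> and \<open>n\<close> have a common eigenvector on a third line, so \<open>n t\<close> and \<open>t n\<close> agree there
  and are equal. Hence \<open>t\<close> has the same eigenvalue on \<open>A\<close> and on \<open>B\<close>. So \<open>t\<close> is a scalar matrix and
  central in \<open>D\<close> (\<open>frame_stabilizer_central\<close>).

  Now take three lines \<open>A\<close>, \<open>B\<close>, \<open>C\<close> and elements \<open>n\<close>, \<open>m\<close> of \<open>D\<close> that swap \<open>A, B\<close> and \<open>B, C\<close>. The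
  squares of \<open>n\<close> and \<open>m\<close> and the cube of \<open>n m\<close> preserve all lines and are central. It follows that
  \<open>p = m n\<close> and \<open>q = n m\<close> commute and have the same cube, so \<open>p = q\<close> or \<open>p\<^sup>2 + p q + q\<^sup>2 = 0\<close> in the
  division ring \<open>D\<close>. Both are impossible: \<open>p\<close> and \<open>q\<close> send \<open>A\<close> to different lines, and so do
  \<open>p\<^sup>2\<close>, \<open>p q\<close> and \<open>q\<^sup>2\<close>, whose images of a vector of \<open>A\<close> are thus linearly independent
  (\<open>not_all_swaps\<close>).\<close>

section \<open>Representations of a division ring\<close>

text \<open>The type of square matrices carries componentwise multiplication as its ring structure, so
  \<^const>\<open>unital_ring_hom\<close> does not express compatibility with the matrix product.\<close>

definition matrix_representation :: "('d::division_ring \<Rightarrow> 'k::field ^ 'n ^ 'n) \<Rightarrow> bool" where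
  "matrix_representation \<phi> \<longleftrightarrow>
     \<phi> 1 = mat 1 \<and> (\<forall>a b. \<phi> (a + b) = \<phi> a + \<phi> b) \<and> (\<forall>a b. \<phi> (a * b) = \<phi> a ** \<phi> b)"

lemma splitting_representation_is_matrix_representation:
  assumes cda: "central_division_algebra \<iota>" and rep: "splitting_representation \<iota> j \<phi>"
  shows "matrix_representation \<phi>"
proof -
  obtain \<psi> where iso: "\<psi> \<in> ring_iso (tensor_algebra \<iota> j) matrix_ring"
    and scal: "\<And>k. \<psi> (pure_tensor \<iota> j 1 k) = mat k"
    and \<phi>: "\<And>a. \<phi> a = \<psi> (pure_tensor \<iota> j a 1)"
    using rep by (auto simp: splitting_representation_def splitting_isomorphism_def)
  interpret I: ideal "tensor_null \<iota> j" formal_ring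
    by (rule tensor_null_ideal[OF cda])
  have hom\<psi>: "\<psi> \<in> ring_hom (tensor_algebra \<iota> j) matrix_ring"
    using iso by (simp add: ring_iso_def)
  have hom: "(\<lambda>s. \<psi> (tensor_null \<iota> j +>\<^bsub>formal_ring\<^esub> s)) \<in> ring_hom formal_ring matrix_ring"
    using ring_hom_trans[OF I.rcos_ring_hom hom\<psi>[unfolded tensor_algebra_def]]
    by (simp add: comp_def)
  let ?h = "\<lambda>s. \<psi> (tensor_null \<iota> j +>\<^bsub>formal_ring\<^esub> s)"
  have hmult: "?h (formal_mult s t) = ?h s ** ?h t" and hadd: "?h (s + t) = ?h s + ?h t" for s t
    using ring_hom_mult[OF hom, of s t] ring_hom_add[OF hom, of s t]
    by (simp_all add: formal_ring_def matrix_ring_def)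
  \<comment> \<open>additivity of \<open>a \<mapsto> a \<otimes> 1\<close>: the two representatives differ by a bilinearity relation\<close>
  have hsum: "tensor_null \<iota> j +>\<^bsub>formal_ring\<^esub> frag_of (a + b, 1)
      = tensor_null \<iota> j +>\<^bsub>formal_ring\<^esub> (frag_of (a, 1) + frag_of (b, 1))" for a b
  proof -
    have "frag_of (a + b, 1) - frag_of (a, 1) - frag_of (b, 1) \<in> tensor_null \<iota> j"
      unfolding tensor_null_def bilinearity_relations_def by (rule generate.incl) blast
    moreover have "frag_of (a + b, 1) = (frag_of (a + b, 1) - frag_of (a, 1) - frag_of (b, 1))
        \<oplus>\<^bsub>formal_ring\<^esub> (frag_of (a, 1) + frag_of (b, 1))"
      by (simp add: formal_ring_def)
    ultimately have "frag_of (a + b, 1)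
        \<in> tensor_null \<iota> j +>\<^bsub>formal_ring\<^esub> (frag_of (a, 1) + frag_of (b, 1))"
      unfolding a_r_coset_def' by blast
    then show ?thesis
      by (intro I.a_repr_independence[symmetric] I.a_subgroup) (simp_all add: formal_ring_def)
  qed
  show ?thesis
    unfolding matrix_representation_def
  proof (intro conjI allI)
    show "\<phi> 1 = mat 1"
      using scal[of 1] by (simp add: \<phi>)
    show "\<phi> (a + b) = \<phi> a + \<phi> b" for a b
      using hadd[of "frag_of (a, 1)" "frag_of (b, 1)"] by (simp add: \<phi> pure_tensor_def hsum)
    show "\<phi> (a * b) = \<phi> a ** \<phi> b" for a b
      using hmult[of "frag_of (a, 1)" "frag_of (b, 1)"]
      by (simp add: \<phi> pure_tensor_def formal_mult_of)
  qed
qed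


lemma matrix_representation_minus:
  assumes "matrix_representation \<phi>"
  shows "\<phi> 0 = 0" and "\<phi> (x - y) = \<phi> x - \<phi> y"
proof -
  have add: "\<phi> (u + v) = \<phi> u + \<phi> v" for u v
    using assms by (simp add: matrix_representation_def)
  show "\<phi> 0 = 0"
    using add[of 0 0] by simp
  show "\<phi> (x - y) = \<phi> x - \<phi> y"
    using add[of "x - y" y] by simp
qed

lemma matrix_representation_kills_no_vector:
  fixes \<phi> :: "'d::division_ring \<Rightarrow> 'k::field ^ 'n ^ 'n"
  assumes \<phi>: "matrix_representation \<phi>" and v: "\<phi> a *v v = 0" "v \<noteq> 0"
  shows "a = 0"
proof (rule ccontr)
  assume "a \<noteq> 0"
  then have "\<phi> (inverse a) ** \<phi> a = mat 1"
    using \<phi> by (metis left_inverse matrix_representation_def)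
  then have "v = \<phi> (inverse a) *v (\<phi> a *v v)"
    by (simp add: matrix_vector_mul_assoc)
  then show False
    using v by simp
qed

text \<open>The form in which the division property enters the argument below: an identity between
  elements of the division ring can be checked on one nonzero vector.\<close>

lemma matrix_representation_eqI:
  fixes \<phi> :: "'d::division_ring \<Rightarrow> 'k::field ^ 'n ^ 'n"
  assumes \<phi>: "matrix_representation \<phi>" and "\<phi> a *v v = \<phi> b *v v" "v \<noteq> 0"
  shows "a = b"
  using matrix_representation_kills_no_vector[OF \<phi>, of "a - b" v] assms
  by (simp add: matrix_representation_minus matrix_vector_mult_diff_rdistrib)

lemma linear_action_mult:
  assumes "matrix_representation \<phi>"
  shows "linear_action \<phi> (a * b) U = linear_action \<phi> a (linear_action \<phi> b U)"
  using assms by (simp add: linear_action_def matrix_representation_def image_image matrix_vector_mul_assoc)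

lemma inj_linear_action_vector:
  fixes \<phi> :: "'d::division_ring \<Rightarrow> 'k::field ^ 'n ^ 'n"
  assumes \<phi>: "matrix_representation \<phi>" and "a \<noteq> 0"
  shows "inj ((*v) (\<phi> a))"
proof (rule injI)
  fix v w assume "\<phi> a *v v = \<phi> a *v w"
  then have "\<phi> a *v (v - w) = 0"
    by (simp add: matrix_vector_mult_diff_distrib)
  then show "v = w"
    using matrix_representation_kills_no_vector[OF \<phi>] \<open>a \<noteq> 0\<close> by fastforce
qed

section \<open>Frames\<close>

lemma finite_frame: "frame \<L> \<Longrightarrow> finite \<L>"
  by (simp add: frame_def card_ge_0_finite)

lemma frame_line_subspace: "frame \<L> \<Longrightarrow> L \<in> \<L> \<Longrightarrow> vec.subspace L"
  by (simp add: frame_def)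

lemma span_frame:
  fixes \<L> :: "('k::field ^ 'n) set set"
  assumes "frame \<L>"
  shows "vec.span (\<Union>\<L>) = UNIV"
proof -
  have "v \<in> vec.span (\<Union>\<L>)" for v
  proof -
    obtain c where c: "c \<in> (\<Pi>\<^sub>E L\<in>\<L>. L)" "v = (\<Sum>L\<in>\<L>. c L)"
      using assms unfolding frame_def by blast
    show ?thesis
      unfolding c(2) using c(1) by (intro vec.span_sum vec.span_base) blast
  qed
  then show ?thesis
    by blast
qed

lemma span_Union_spans:
  fixes b :: "('k::field ^ 'n) set \<Rightarrow> 'k ^ 'n"
  assumes "\<And>L. L \<in> S \<Longrightarrow> L = vec.span {b L}"
  shows "vec.span (\<Union>S) = vec.span (b ` S)"
proof
  have "L \<subseteq> vec.span (b ` S)" if "L \<in> S" for L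
    using assms[OF that] vec.span_mono[of "{b L}" "b ` S"] that by blast
  then show "vec.span (\<Union>S) \<subseteq> vec.span (b ` S)"
    by (intro vec.span_minimal) auto
  have "b L \<in> L" if "L \<in> S" for L
    using assms[OF that] vec.span_base by blast
  then show "vec.span (b ` S) \<subseteq> vec.span (\<Union>S)"
    by (intro vec.span_mono) auto
qed

text \<open>Spanning vectors of the lines generate a space whose dimension is their number, so they are
  independent. This gives access to the library on bases.\<close>

lemma frame_basis:
  fixes \<L> :: "('k::field ^ 'n) set set"
  assumes "frame \<L>"
  obtains b where "\<And>L. L \<in> \<L> \<Longrightarrow> L = vec.span {b L}" "inj_on b \<L>" "vec.independent (b ` \<L>)"
proof -
  have card: "card \<L> = CARD('n)" and line: "\<And>L. L \<in> \<L> \<Longrightarrow> vec.subspace L \<and> vec.dim L = 1"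
    using assms unfolding frame_def by blast+
  have "\<exists>v. L = vec.span {v}" if L: "L \<in> \<L>" for L
  proof -
    obtain B where B: "B \<subseteq> L" "L \<subseteq> vec.span B" "card B = vec.dim L"
      by (metis vec.basis_exists)
    then obtain v where "B = {v}"
      using line[OF L] by (metis card_1_singletonE)
    then show ?thesis
      using B line[OF L] vec.span_minimal by blast
  qed
  then obtain b where b: "\<And>L. L \<in> \<L> \<Longrightarrow> L = vec.span {b L}"
    by metis
  have inj: "inj_on b \<L>"
    using b by (metis inj_onI)
  have "vec.span (b ` \<L>) = UNIV"
    using span_Union_spans[of \<L> b] b span_frame[OF assms] by simp
  moreover have "card (b ` \<L>) \<le> vec.dim (UNIV :: ('k ^ 'n) set)"
    by (simp only: card_image[OF inj] card vec_dim_card)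
  ultimately have "vec.independent (b ` \<L>)"
    using finite_frame[OF assms] by (intro vec.card_le_dim_spanning[of _ UNIV]) auto
  then show ?thesis
    using that b inj by blast
qed

lemma frame_line_nonzero:
  assumes "frame \<L>" "L \<in> \<L>"
  obtains v where "v \<in> L" "v \<noteq> 0"
proof -
  have "vec.dim L = 1"
    using assms by (simp add: frame_def)
  then have "\<not> L \<subseteq> {0}"
    by (metis vec.dim_eq_0 zero_neq_one)
  then show ?thesis
    using that by blast
qed

lemma frame_line_scalar:
  assumes "frame \<L>" "L \<in> \<L>" "v \<in> L" "v \<noteq> 0" "w \<in> L"
  obtains k where "w = k *s v"
proof -
  obtain b where b: "L = vec.span {b L}"
    using frame_basis[OF assms(1)] assms(2) by metis
  then obtain x y where "v = x *s b L" "w = y *s b L"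
    using assms(3,5) unfolding vec.span_singleton by blast
  moreover from this have "x \<noteq> 0"
    using assms(4) by auto
  ultimately have "w = (y / x) *s v"
    by simp
  then show ?thesis
    using that by blast
qed

lemma dim_span_frame:
  assumes "frame \<L>" "S \<subseteq> \<L>"
  shows "vec.dim (vec.span (\<Union>S)) = card S"
proof -
  obtain b where b: "\<And>L. L \<in> \<L> \<Longrightarrow> L = vec.span {b L}" "inj_on b \<L>" "vec.independent (b ` \<L>)"
    using frame_basis[OF assms(1)] by metis
  have "vec.span (\<Union>S) = vec.span (b ` S)"
    using b(1) assms(2) by (intro span_Union_spans) auto
  moreover have "vec.independent (b ` S)"
    using b(3) assms(2) by (meson image_mono vec.independent_mono)
  moreover have "inj_on b S"
    using b(2) assms(2) inj_on_subset by blast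
  ultimately show ?thesis
    by (simp add: vec.dim_eq_card_independent card_image)
qed

text \<open>Independence in terms of lines. It makes \<open>S \<mapsto> span (\<Union>S)\<close> an order embedding
  of the subsets of a frame.\<close>

lemma line_of_vector_in_span_frame:
  assumes "frame \<L>" "S \<subseteq> \<L>" "L \<in> \<L>" "v \<in> L" "v \<noteq> 0" "v \<in> vec.span (\<Union>S)"
  shows "L \<in> S"
proof (rule ccontr)
  assume "L \<notin> S"
  obtain b where b: "\<And>L. L \<in> \<L> \<Longrightarrow> L = vec.span {b L}" "inj_on b \<L>" "vec.independent (b ` \<L>)"
    using frame_basis[OF assms(1)] by metis
  have "b L \<in> L"
    using b(1)[OF assms(3)] vec.span_base by blast
  then obtain k where k: "b L = k *s v"
    using frame_line_scalar assms by metis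
  have "b L \<in> vec.span (\<Union>S)"
    unfolding k by (rule vec.span_scale[OF assms(6)])
  then have "b L \<in> vec.span (b ` S)"
    using span_Union_spans[of S b] b(1) assms(2) by auto
  moreover have "b ` S \<subseteq> b ` \<L> - {b L}"
    using \<open>L \<notin> S\<close> assms(2,3) b(2) by (auto simp: inj_on_def)
  ultimately have "b L \<in> vec.span (b ` \<L> - {b L})"
    using vec.span_mono by blast
  then show False
    using b(3) assms(3) by (auto simp: vec.dependent_def)
qed

lemma span_frame_mono_iff:
  assumes "frame \<L>" "S \<subseteq> \<L>" "T \<subseteq> \<L>"
  shows "vec.span (\<Union>S) \<subseteq> vec.span (\<Union>T) \<longleftrightarrow> S \<subseteq> T"
proof
  assume sub: "vec.span (\<Union>S) \<subseteq> vec.span (\<Union>T)"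
  show "S \<subseteq> T"
  proof
    fix L assume L: "L \<in> S"
    then obtain v where v: "v \<in> L" "v \<noteq> 0"
      using frame_line_nonzero assms by blast
    have "v \<in> vec.span (\<Union>S)"
      using v L by (auto intro: vec.span_base)
    then show "L \<in> T"
      using line_of_vector_in_span_frame[OF assms(1,3) _ v] sub L assms(2) by blast
  qed
next
  assume "S \<subseteq> T"
  then show "vec.span (\<Union>S) \<subseteq> vec.span (\<Union>T)"
    by (intro vec.span_mono) auto
qed

lemma frame_three_lines_independent:
  assumes "frame \<L>" "A \<in> \<L>" "B \<in> \<L>" "C \<in> \<L>" "A \<noteq> B" "A \<noteq> C"
    and "u \<in> A" "v \<in> B" "w \<in> C" "u + v + w = 0"
  shows "u = 0"
proof (rule ccontr)
  assume "u \<noteq> 0"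
  have "u = - (v + w)"
    using assms(10) by (metis add.assoc eq_neg_iff_add_eq_0)
  moreover have "v \<in> vec.span (\<Union>{B, C})" "w \<in> vec.span (\<Union>{B, C})"
    using assms by (auto intro: vec.span_base)
  ultimately have "u \<in> vec.span (\<Union>{B, C})"
    using vec.span_add vec.span_neg by metis
  then have "A \<in> {B, C}"
    using line_of_vector_in_span_frame[OF assms(1), of "{B, C}" A u] assms \<open>u \<noteq> 0\<close> by blast
  then show False
    using assms by blast
qed

section \<open>No division ring realizes all transpositions of a frame\<close>

definition swaps :: "('d \<Rightarrow> 'k::field ^ 'n ^ 'n) \<Rightarrow> ('k ^ 'n) set set \<Rightarrow>
    'd \<Rightarrow> ('k ^ 'n) set \<Rightarrow> ('k ^ 'n) set \<Rightarrow> bool" where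
  "swaps \<phi> \<L> n A B \<longleftrightarrow> linear_action \<phi> n A = B \<and> linear_action \<phi> n B = A \<and>
     (\<forall>L\<in>\<L> - {A, B}. linear_action \<phi> n L = L)"

lemma stabilized_line_eigenvalue:
  assumes fr: "frame \<L>" "L \<in> \<L>" and t: "linear_action \<phi> t L = L"
  obtains k where "\<And>v. v \<in> L \<Longrightarrow> \<phi> t *v v = k *s v"
proof -
  obtain v where v: "v \<in> L" "v \<noteq> 0"
    using frame_line_nonzero[OF fr] .
  have "\<phi> t *v v \<in> L"
    using t v by (auto simp: linear_action_def)
  then obtain k where k: "\<phi> t *v v = k *s v"
    using frame_line_scalar[OF fr v] by metis
  have "\<phi> t *v w = k *s w" if w: "w \<in> L" for w
  proof -
    obtain x where "w = x *s v"
      using frame_line_scalar[OF fr v w] .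
    then show ?thesis
      by (simp add: vector_scalar_commute k mult.commute)
  qed
  then show ?thesis
    using that by blast
qed

text \<open>A swap of \<open>A\<close> and \<open>B\<close> commutes with \<open>t\<close>, because the two share an eigenvector on a third line;
  conjugating by it shows that \<open>t\<close> has the same eigenvalue on \<open>A\<close> and \<open>B\<close>. Hence \<open>t\<close> acts as a
  scalar.\<close>

lemma frame_stabilizer_central:
  fixes \<phi> :: "'d::division_ring \<Rightarrow> 'k::field ^ 'n ^ 'n"
  assumes \<phi>: "matrix_representation \<phi>" and fr: "frame \<L>" and d: "card \<L> > 2"
    and sw: "\<And>A B. A \<in> \<L> \<Longrightarrow> B \<in> \<L> \<Longrightarrow> A \<noteq> B \<Longrightarrow> \<exists>n. n \<noteq> 0 \<and> swaps \<phi> \<L> n A B"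
    and t: "\<And>L. L \<in> \<L> \<Longrightarrow> linear_action \<phi> t L = L"
  shows "t * a = a * t"
proof -
  have \<phi>mult: "\<phi> (x * y) *v v = \<phi> x *v (\<phi> y *v v)" for x y v
    using \<phi> by (simp add: matrix_representation_def matrix_vector_mul_assoc)
  have "\<exists>k. \<forall>v\<in>L. \<phi> t *v v = k *s v" if "L \<in> \<L>" for L
    using stabilized_line_eigenvalue[OF fr that t[OF that]] by metis
  then obtain \<tau> where \<tau>: "\<And>L v. L \<in> \<L> \<Longrightarrow> v \<in> L \<Longrightarrow> \<phi> t *v v = \<tau> L *s v"
    by metis
  have eq: "\<tau> A = \<tau> B" if A: "A \<in> \<L>" and B: "B \<in> \<L>" and AB: "A \<noteq> B" for A B
  proof -
    obtain n where n: "n \<noteq> 0" "swaps \<phi> \<L> n A B"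
      using sw[OF A B AB] by blast
    have "\<not> \<L> \<subseteq> {A, B}"
      using d card_mono[of "{A, B}" \<L>] AB by auto
    then obtain C where C: "C \<in> \<L>" "C \<noteq> A" "C \<noteq> B"
      by blast
    then obtain v where v: "v \<in> C" "v \<noteq> 0"
      using frame_line_nonzero[OF fr] by metis
    have nC: "linear_action \<phi> n C = C"
      using n(2) C by (simp add: swaps_def)
    obtain k where k: "\<And>v. v \<in> C \<Longrightarrow> \<phi> n *v v = k *s v"
      using stabilized_line_eigenvalue[OF fr C(1) nC] by blast
    have "\<phi> (n * t) *v v = \<phi> (t * n) *v v"
      using \<tau>[OF C(1) v(1)] k[OF v(1)] by (simp add: \<phi>mult vector_scalar_commute mult.commute)
    then have comm: "n * t = t * n"
      using matrix_representation_eqI[OF \<phi>] v(2) by blast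
    obtain w where w: "w \<in> A" "w \<noteq> 0"
      using frame_line_nonzero[OF fr A] .
    have "\<phi> n *v w \<in> B"
      using n(2) w(1) by (auto simp: swaps_def linear_action_def)
    then have "\<tau> B *s (\<phi> n *v w) = \<phi> (t * n) *v w"
      by (simp add: \<phi>mult \<tau>[OF B])
    also have "\<dots> = \<tau> A *s (\<phi> n *v w)"
      unfolding comm[symmetric] by (simp add: \<phi>mult \<tau>[OF A w(1)] vector_scalar_commute)
    finally show ?thesis
      using matrix_representation_kills_no_vector[OF \<phi> _ w(2)] n(1) by auto
  qed
  obtain L0 where L0: "L0 \<in> \<L>"
    using d by fastforce
  have scalar: "\<phi> t *v w = \<tau> L0 *s w" for w
  proof -
    obtain c where c: "c \<in> (\<Pi>\<^sub>E L\<in>\<L>. L)" "w = (\<Sum>L\<in>\<L>. c L)"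
      using fr unfolding frame_def by blast
    have "\<phi> t *v c L = \<tau> L0 *s c L" if "L \<in> \<L>" for L
      using \<tau>[OF that, of "c L"] eq[OF that L0] c(1) that by (cases "L = L0") auto
    then show ?thesis
      unfolding c(2) by (simp add: vec.linear_sum[OF matrix_vector_mul_linear_gen] vec.scale_sum_right)
  qed
  obtain v where "v \<noteq> (0 :: 'k ^ 'n)"
    using frame_line_nonzero[OF fr L0] by metis
  then show ?thesis
    by (intro matrix_representation_eqI[OF \<phi>, of _ v])
      (simp_all add: \<phi>mult scalar vector_scalar_commute)
qed

text \<open>The factorization \<open>p\<^sup>3 - q\<^sup>3 = (p - q) (p\<^sup>2 + p q + q\<^sup>2)\<close> and the absence of zero divisors.\<close>

lemma commuting_equal_cubes:
  fixes p q :: "'d::division_ring"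
  assumes "p * q = q * p" "p * p * p = q * q * q" "p \<noteq> q"
  shows "p * p + p * q + q * q = 0"
proof -
  have "(p - q) * (p * p + p * q + q * q) = p * p * p - q * q * q"
    by (simp add: algebra_simps) (metis assms(1) mult.assoc)
  then show ?thesis
    using assms by simp
qed

text \<open>The two products of adjacent transpositions are mutually inverse 3-cycles. Centrality of
  \<open>n\<^sup>2\<close>, \<open>m\<^sup>2\<close> and \<open>q\<^sup>3\<close> forces the ratio of the corresponding elements \<open>p\<close>, \<open>q\<close> to be a primitive cube
  root of unity or \<open>1\<close>, whereas this ratio itself permutes three independent lines cyclically.\<close>

lemma not_all_swaps:
  fixes \<phi> :: "'d::division_ring \<Rightarrow> 'k::field ^ 'n ^ 'n"
  assumes \<phi>: "matrix_representation \<phi>" and fr: "frame \<L>" and d: "card \<L> > 2"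
    and sw: "\<And>A B. A \<in> \<L> \<Longrightarrow> B \<in> \<L> \<Longrightarrow> A \<noteq> B \<Longrightarrow> \<exists>n. n \<noteq> 0 \<and> swaps \<phi> \<L> n A B"
  shows False
proof -
  note [simp] = linear_action_mult[OF \<phi>]
  have central: "t * a = a * t" if "\<And>L. L \<in> \<L> \<Longrightarrow> linear_action \<phi> t L = L" for t a
    using frame_stabilizer_central[OF \<phi> fr d sw that] .
  have "\<exists>T\<subseteq>\<L>. card T = 3"
    using d obtain_subset_with_card_n[of 3 \<L>] by auto
  then obtain A B C where L: "A \<in> \<L>" "B \<in> \<L>" "C \<in> \<L>" "A \<noteq> B" "A \<noteq> C" "B \<noteq> C"
    by (auto simp: card_3_iff)
  obtain n where n: "n \<noteq> 0" "swaps \<phi> \<L> n A B"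
    using sw[OF L(1,2,4)] by blast
  obtain m where m: "m \<noteq> 0" "swaps \<phi> \<L> m B C"
    using sw[OF L(2,3,6)] by blast
  have nL: "linear_action \<phi> n L = (if L = A then B else if L = B then A else L)" if "L \<in> \<L>" for L
    using n(2) that by (auto simp: swaps_def)
  have mL: "linear_action \<phi> m L = (if L = B then C else if L = C then B else L)" if "L \<in> \<L>" for L
    using m(2) that by (auto simp: swaps_def)
  define p q where "p = m * n" and "q = n * m"
  have n2: "n * n * a = a * (n * n)" and m2: "m * m * a = a * (m * m)" for a
    using L by (intro central; simp add: nL mL)+
  have q3: "q * q * q * a = a * (q * q * q)" for a
    using L by (intro central) (simp add: nL mL q_def)
  have "p * q = m * (n * n) * m"
    by (simp add: p_def q_def mult.assoc)
  also have "\<dots> = n * n * (m * m)"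
    by (metis n2 mult.assoc)
  also have "\<dots> = n * (m * m) * n"
    by (metis m2 mult.assoc)
  also have "\<dots> = q * p"
    by (simp add: p_def q_def mult.assoc)
  finally have comm: "p * q = q * p" .
  \<comment> \<open>\<open>n\<close> conjugates \<open>p = m n\<close> to \<open>q = n m\<close>, and the cube of \<open>q\<close> is central\<close>
  have "n * (p * p * p) = q * q * q * n"
    by (simp add: p_def q_def mult.assoc)
  also have "\<dots> = n * (q * q * q)"
    by (rule q3)
  finally have cubes: "p * p * p = q * q * q"
    using n(1) by simp
  obtain v where v: "v \<in> A" "v \<noteq> 0"
    using frame_line_nonzero[OF fr L(1)] .
  have in_line: "\<phi> x *v v \<in> linear_action \<phi> x A" for x
    using v(1) by (auto simp: linear_action_def)
  have pA: "linear_action \<phi> p A = C" and qA: "linear_action \<phi> q A = B"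
    and ppA: "linear_action \<phi> (p * p) A = B" and pqA: "linear_action \<phi> (p * q) A = A"
    and qqA: "linear_action \<phi> (q * q) A = C"
    using L by (simp_all add: p_def q_def nL mL)
  have nz: "p * q \<noteq> 0"
    using n(1) m(1) by (simp add: p_def q_def)
  have "p \<noteq> q"
    using pA qA L(6) by blast
  then have sum0: "p * p + p * q + q * q = 0"
    using commuting_equal_cubes comm cubes by blast
  \<comment> \<open>applied to \<open>v\<close>, the three summands lie on the lines \<open>A\<close>, \<open>B\<close> and \<open>C\<close>\<close>
  have "\<phi> (p * q + p * p + q * q) = 0"
    using sum0 matrix_representation_minus(1)[OF \<phi>] by (simp add: add.commute)
  then have "\<phi> (p * q) *v v + \<phi> (p * p) *v v + \<phi> (q * q) *v v = 0"
    using \<phi> by (metis matrix_representation_def matrix_vector_mult_0 matrix_vector_mult_add_rdistrib)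
  then have "\<phi> (p * q) *v v = 0"
    using frame_three_lines_independent[OF fr L(1-5)] in_line pqA ppA qqA by metis
  then show False
    using matrix_representation_kills_no_vector[OF \<phi> _ v(2)] nz by blast
qed

section \<open>Chambers of an apartment\<close>

text \<open>The chamber that an ordering of the lines of a frame determines.\<close>

definition list_flag :: "('k::field ^ 'n) set list \<Rightarrow> ('k ^ 'n) set set" where
  "list_flag xs = {vec.span (\<Union>(set (take k xs))) | k. 0 < k \<and> k < length xs}"

lemma span_frame_proper:
  fixes \<L> :: "('k::field ^ 'n) set set"
  assumes fr: "frame \<L>" and S: "S \<subseteq> \<L>" "0 < card S" "card S < CARD('n)"
  shows "vec.span (\<Union>S) \<noteq> {0}" "vec.span (\<Union>S) \<noteq> UNIV"
proof -
  have "vec.dim (vec.span (\<Union>S)) = card S"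
    using dim_span_frame[OF fr S(1)] .
  moreover have "vec.dim ({0} :: ('k ^ 'n) set) = 0"
    by (simp add: vec.dim_eq_0)
  ultimately show "vec.span (\<Union>S) \<noteq> {0}" "vec.span (\<Union>S) \<noteq> UNIV"
    using S(2,3) by (metis less_irrefl, metis vec_dim_card less_irrefl)
qed

text \<open>For maximality: the flag has a member in every dimension from \<open>1\<close> to \<open>d - 1\<close>, and a vertex of
  the apartment that is comparable with the member of its own dimension equals it.\<close>

lemma list_flag_is_chamber:
  fixes \<L> :: "('k::field ^ 'n) set set"
  assumes fr: "frame \<L>" and xs: "distinct xs" "set xs = \<L>"
  shows "list_flag xs \<in> chambers (frame_apartment \<L>)"
proof -
  have len: "length xs = CARD('n)"
    using fr xs by (metis distinct_card frame_def)
  have sub: "set (take k xs) \<subseteq> \<L>" for k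
    using xs(2) set_take_subset by metis
  have ctake: "card (set (take k xs)) = k" if "k \<le> length xs" for k
    using that xs(1) by (simp add: distinct_card)
  have mono: "vec.span (\<Union>(set (take k xs))) \<subseteq> vec.span (\<Union>(set (take l xs)))" if "k \<le> l" for k l
    using that by (intro vec.span_mono Union_mono set_take_subset_set_take)
  have "chain\<^sub>\<subseteq> (list_flag xs)"
    unfolding chain_subset_def
  proof (intro ballI)
    fix U V assume "U \<in> list_flag xs" "V \<in> list_flag xs"
    then obtain k l where "U = vec.span (\<Union>(set (take k xs)))" "V = vec.span (\<Union>(set (take l xs)))"
      unfolding list_flag_def by blast
    then show "U \<subseteq> V \<or> V \<subseteq> U"
      using mono nat_le_linear[of k l] by metis
  qed
  moreover have "vec.subspace U \<and> U \<noteq> {0} \<and> U \<noteq> UNIV" if "U \<in> list_flag xs" for U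
    using that span_frame_proper[OF fr sub] ctake len by (auto simp: list_flag_def)
  ultimately have "list_flag xs \<in> building"
    unfolding building_def by blast
  then have mem: "list_flag xs \<in> frame_apartment \<L>"
    using sub by (auto simp: frame_apartment_def list_flag_def)
  have "\<sigma> \<subseteq> list_flag xs" if \<sigma>: "\<sigma> \<in> frame_apartment \<L>" and le: "list_flag xs \<subseteq> \<sigma>" for \<sigma>
  proof
    fix U assume U: "U \<in> \<sigma>"
    then obtain S where S: "S \<subseteq> \<L>" "U = vec.span (\<Union>S)"
      using \<sigma> unfolding frame_apartment_def by blast
    have proper: "U \<noteq> {0}" "U \<noteq> UNIV" and chain: "chain\<^sub>\<subseteq> \<sigma>"
      using \<sigma> U unfolding frame_apartment_def building_def by auto
    have "S \<noteq> {}"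
      using S(2) proper(1) by auto
    then have "0 < card S"
      using S(1) finite_frame[OF fr] by (simp add: card_gt_0_iff finite_subset)
    moreover have "S \<subset> \<L>"
      using S proper(2) span_frame[OF fr] by blast
    then have "card S < length xs"
      using psubset_card_mono[OF finite_frame[OF fr]] distinct_card[OF xs(1)] xs(2) by simp
    ultimately have cS: "0 < card S" "card S < length xs"
      by blast+
    define V where "V = vec.span (\<Union>(set (take (card S) xs)))"
    have V: "V \<in> list_flag xs"
      using cS by (auto simp: V_def list_flag_def)
    then have "U \<subseteq> V \<or> V \<subseteq> U"
      using chain U le unfolding chain_subset_def by blast
    then have "S \<subseteq> set (take (card S) xs) \<or> set (take (card S) xs) \<subseteq> S"
      unfolding V_def S(2) using span_frame_mono_iff[OF fr] sub S(1) by simp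
    then have "S = set (take (card S) xs)"
      using ctake[of "card S"] cS S(1) finite_frame[OF fr]
      by (metis List.finite_set card_subset_eq finite_subset less_imp_le)
    then show "U \<in> list_flag xs"
      using V S(2) V_def by simp
  qed
  then show ?thesis
    using mem by (auto simp: chambers_def)
qed

lemma distinct_eq_by_set_take:
  assumes "distinct xs" "distinct ys" "length xs = length ys"
    and "\<And>k. k \<le> length xs \<Longrightarrow> set (take k xs) = set (take k ys)"
  shows "xs = ys"
proof (rule nth_equalityI[OF assms(3)])
  fix i assume i: "i < length xs"
  have "insert (xs ! i) (set (take i xs)) = insert (ys ! i) (set (take i ys))"
    using assms(4)[of "Suc i"] i assms(3) by (simp add: take_Suc_conv_app_nth)
  moreover have "xs ! i \<notin> set (take i xs)"
    using assms(1) i by (auto simp: in_set_conv_nth nth_eq_iff_index_eq)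
  ultimately show "xs ! i = ys ! i"
    using assms(4)[of i] i by auto
qed

lemma linear_action_span_Union:
  "linear_action \<phi> h (vec.span (\<Union>S)) = vec.span (\<Union>(linear_action \<phi> h ` S))"
  unfolding linear_action_def
  by (simp add: vec.linear_span_image[OF matrix_vector_mul_linear_gen, symmetric] image_Union)

lemma dim_linear_action:
  fixes \<phi> :: "'d::division_ring \<Rightarrow> 'k::field ^ 'n ^ 'n"
  assumes "matrix_representation \<phi>" "h \<noteq> 0"
  shows "vec.dim (linear_action \<phi> h U) = vec.dim U"
  unfolding linear_action_def
  by (rule vec.dim_image_eq[OF matrix_vector_mul_linear_gen])
    (rule inj_on_subset[OF inj_linear_action_vector[OF assms] subset_UNIV])

text \<open>A line of the frame is a vertex of the apartment, so its image is one too, and the vertices of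
  dimension \<open>1\<close> are the lines of the frame. The assumption \<open>d > 1\<close> makes the lines proper
  subspaces.\<close>

lemma apartment_stabilizer_permutes_frame:
  fixes \<phi> :: "'d::division_ring \<Rightarrow> 'k::field ^ 'n ^ 'n"
  assumes \<phi>: "matrix_representation \<phi>" and fr: "frame \<L>" and d: "CARD('n) > 1"
    and h: "h \<in> complex_stabilizer {a. a \<noteq> 0} (linear_action \<phi>) (frame_apartment \<L>)"
  shows "linear_action \<phi> h ` \<L> \<subseteq> \<L>"
proof
  fix M assume "M \<in> linear_action \<phi> h ` \<L>"
  then obtain L where L: "L \<in> \<L>" "M = linear_action \<phi> h L"
    by blast
  have span1: "vec.span (\<Union>{L}) = L" if "L \<in> \<L>" for L
    using frame_line_subspace[OF fr that] by (simp add: vec.span_eq_iff)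
  have "L \<noteq> {0}" "L \<noteq> UNIV"
    using span_frame_proper[OF fr, of "{L}"] d L(1) span1 by auto
  then have "{L} \<in> frame_apartment \<L>"
    using L(1) span1[OF L(1)] frame_line_subspace[OF fr L(1)]
    unfolding frame_apartment_def building_def chain_subset_def
    by (intro CollectI conjI ballI exI[of _ "{L}"])
      (use span1[OF L(1), symmetric] in simp_all)
  then have "{M} \<in> frame_apartment \<L>"
    using h L(2) by (auto simp: complex_stabilizer_def)
  then obtain S where S: "S \<subseteq> \<L>" "M = vec.span (\<Union>S)"
    by (auto simp: frame_apartment_def)
  have "card S = vec.dim M"
    using dim_span_frame[OF fr S(1)] S(2) by simp
  also have "\<dots> = 1"
    using L fr dim_linear_action[OF \<phi>, of h L] h by (auto simp: complex_stabilizer_def frame_def)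
  finally obtain N where "S = {N}"
    by (rule card_1_singletonE)
  then have "N \<in> \<L>" "M = N"
    using S span1[of N] by blast+
  then show "M \<in> \<L>"
    by simp
qed

text \<open>An equality of chambers only says that the sets of members agree. The members have distinct
  dimensions, so they correspond one by one; this determines the set of the first \<open>k\<close> lines for
  every \<open>k\<close>, hence their order.\<close>

lemma stabilizer_maps_lines_in_order:
  fixes \<phi> :: "'d::division_ring \<Rightarrow> 'k::field ^ 'n ^ 'n"
  assumes \<phi>: "matrix_representation \<phi>" and fr: "frame \<L>" and d: "CARD('n) > 1"
    and h: "h \<in> complex_stabilizer {a. a \<noteq> 0} (linear_action \<phi>) (frame_apartment \<L>)"
    and xs: "distinct xs" "set xs = \<L>" and ys: "distinct ys" "set ys = \<L>"
    and flag: "linear_action \<phi> h ` list_flag xs = list_flag ys"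
  shows "map (linear_action \<phi> h) xs = ys"
proof -
  let ?h = "linear_action \<phi> h"
  have h0: "h \<noteq> 0"
    using h by (simp add: complex_stabilizer_def)
  have inj: "inj ?h"
    unfolding linear_action_def using inj_linear_action_vector[OF \<phi> h0]
    by (simp add: inj_image_eq_iff inj_def)
  have perm: "?h ` \<L> \<subseteq> \<L>"
    using apartment_stabilizer_permutes_frame[OF \<phi> fr d h] .
  have onto: "?h ` \<L> = \<L>"
    using perm finite_frame[OF fr] inj by (metis endo_inj_surj inj_on_subset subset_UNIV)
  have len: "length xs = length ys"
    using xs ys by (metis distinct_card)
  have sub: "set (take k ys) \<subseteq> \<L>" "set (take k (map ?h xs)) \<subseteq> \<L>" for k
    using ys(2) xs(2) perm set_take_subset[of k ys] set_take_subset[of k xs]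
    by (auto simp: take_map image_subset_iff subset_iff)
  have dmap: "distinct (map ?h xs)"
    using xs(1) inj by (auto simp: distinct_map intro: inj_on_subset)
  show ?thesis
  proof (rule distinct_eq_by_set_take[OF dmap ys(1)])
    show "length (map ?h xs) = length ys"
      using len by simp
    fix k assume k: "k \<le> length (map ?h xs)"
    consider "k = 0" | "k = length xs" | "0 < k" "k < length xs"
      using k by force
    then show "set (take k (map ?h xs)) = set (take k ys)"
    proof cases
      case 3
      have "?h (vec.span (\<Union>(set (take k xs)))) \<in> list_flag ys"
        unfolding flag[symmetric] using 3 by (auto simp: list_flag_def)
      then obtain l where l: "l < length ys"
        "vec.span (\<Union>(set (take k (map ?h xs)))) = vec.span (\<Union>(set (take l ys)))"
        by (auto simp: list_flag_def linear_action_span_Union take_map)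
      then have eq: "set (take k (map ?h xs)) = set (take l ys)"
        using span_frame_mono_iff[OF fr sub(2) sub(1)] span_frame_mono_iff[OF fr sub(1) sub(2)]
        by (metis subset_antisym subset_refl)
      \<comment> \<open>the number of lines is the dimension, which forces \<open>l = k\<close>\<close>
      have "card (set (take k (map ?h xs))) = k" "card (set (take l ys)) = l"
        using dmap ys(1) 3 l(1) by (simp_all add: distinct_card del: take_map)
      then show ?thesis
        using eq by simp
    qed (use onto xs(2) ys(2) len in auto)
  qed
qed

theorem corollary3p4:
  fixes \<iota> :: "'f::field \<Rightarrow> 'd::division_ring"
    and j :: "'f \<Rightarrow> 'k::field"
    and \<phi> :: "'d \<Rightarrow> 'k ^ 'n ^ 'n"
  assumes "central_division_algebra \<iota>"
    and "has_algebra_degree \<iota> CARD('n)"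
    and "CARD('n) > 2"
    and "field_extension j"
    and "splitting_representation \<iota> j \<phi>"
  shows "\<not> weakly_transitive {a :: 'd. a \<noteq> 0} (linear_action \<phi>)
           (apartments :: ('k ^ 'n) set set set set)"
proof
  assume "weakly_transitive {a :: 'd. a \<noteq> 0} (linear_action \<phi>)
           (apartments :: ('k ^ 'n) set set set set)"
  then obtain \<L> :: "('k ^ 'n) set set" where fr: "frame \<L>" and
    "\<forall>C\<in>chambers (frame_apartment \<L>). \<forall>C'\<in>chambers (frame_apartment \<L>).
      \<exists>h\<in>complex_stabilizer {a. a \<noteq> 0} (linear_action \<phi>) (frame_apartment \<L>).
        linear_action \<phi> h ` C = C'"
    unfolding weakly_transitive_def apartments_def by (elim bexE CollectE exE conjE) metis
  note trans = this(2)[rule_format]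
  have \<phi>: "matrix_representation \<phi>"
    using splitting_representation_is_matrix_representation[OF assms(1,5)] .
  have d1: "CARD('n) > 1"
    using assms(3) by simp
  show False
  proof (rule not_all_swaps[OF \<phi> fr])
    show "card \<L> > 2"
      using fr assms(3) by (simp add: frame_def)
    fix A B assume AB: "A \<in> \<L>" "B \<in> \<L>" "A \<noteq> B"
    obtain zs where zs: "set zs = \<L> - {A, B}" "distinct zs"
      using finite_distinct_list finite_frame[OF fr] by (metis finite_Diff)
    have xs: "distinct (A # B # zs)" "set (A # B # zs) = \<L>"
      and ys: "distinct (B # A # zs)" "set (B # A # zs) = \<L>"
      using AB zs by auto
    obtain h where h: "h \<in> complex_stabilizer {a. a \<noteq> 0} (linear_action \<phi>) (frame_apartment \<L>)"
      "linear_action \<phi> h ` list_flag (A # B # zs) = list_flag (B # A # zs)"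
      using trans[OF list_flag_is_chamber[OF fr xs] list_flag_is_chamber[OF fr ys]] by blast
    \<comment> \<open>two orderings that differ by exchanging the first two lines yield the transposition\<close>
    have "map (linear_action \<phi> h) (A # B # zs) = B # A # zs"
      using stabilizer_maps_lines_in_order[OF \<phi> fr d1 h(1) xs ys h(2)] .
    then have "swaps \<phi> \<L> h A B"
      using zs(1) map_eq_conv[of "linear_action \<phi> h" zs id] by (simp add: swaps_def)
    moreover have "h \<noteq> 0"
      using h(1) by (simp add: complex_stabilizer_def)
    ultimately show "\<exists>n. n \<noteq> 0 \<and> swaps \<phi> \<L> n A B"
      by blast
  qed
qed

end
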